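(* Consider the model $Y=(\Psi^*+A^*B^* )^TX+(B^* )^TW+E$ described in the context, and let $\Theta^*=\Psi^*P_{B^*}^{\perp}$. Then $\Theta^*$ is identifiable (i.e. uniquely determined by the joint law of $(X,Y)$ within the class of configurations satisfying the condition) if either of the following conditions holds: (1) $\Psi^*P_{B^*}+A^*B^*=0$; (2) $\mathrm{rank}(\Sigma_W)=K$ and $\Sigma_E=\tau^2 I_m$ for some $\tau^2$.
   Context: Model. $p,m$ are positive integers. $Y\in\mathbb{R}^m$ (response), $X\in\mathbb{R}^p$ (observed), $Z\in\mathbb{R}^K$ (unobserved hidden variables, $K$ unknown with $1\le K<m$), $E\in\mathbb{R}^m$ (error) are mean-zero random vectors with finite second moments satisfying $Y=(\Psi^* )^TX+(B^* )^TZ+E$, where $\Psi^*\in\mathbb{R}^{p\times m}$, $B^*\in\mathbb{R}^{K\times m}$ are deterministic, $\mathrm{rank}(B^* )=K$, $E$ is independent of $(X,Z)$ with diagonal covariance matrix $\Sigma_E$, and $\Sigma=\mathrm{Cov}(X)$, $\Sigma_Z=\mathrm{Cov}(Z)$ are strictly positive definite. Put $A^*=\{\mathbb{E}[XX^T]\}^{-1}\mathbb{E}[XZ^T]\in\mathbb{R}^{p\times K}$, $W=Z-(A^* )^TX$ (so $\mathrm{Cov}(X,W)=0$), $\Sigma_W=\mathrm{Cov}(W)$. Then $Y=(\Psi^*+A^*B^* )^TX+(B^* )^TW+E$. $P_{B^*}=B^{*T}(B^*B^{*T})^{-1}B^*$ is the orthogonal projection onto the row space of $B^*$ and $P_{B^*}^\perp=I_m-P_{B^*}$.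 A configuration is a choice of an integer $K$ with $1\le K<m$, matrices $\Psi^*\in\mathbb{R}^{p\times m}$, $B^*\in\mathbb{R}^{K\times m}$ and a joint law of $(X,Z,E)$ such that $\mathrm{rank}(B^* )=K$, the vectors $X,Z,E$ have mean zero and finite second moments, $E$ is independent of $(X,Z)$ with diagonal covariance matrix, and $\mathrm{Cov}(X)$, $\mathrm{Cov}(Z)$ are strictly positive definite; it induces a joint law of $(X,Y)$ through $Y=(\Psi^* )^TX+(B^* )^TZ+E$. A quantity attached to configurations is identifiable over a class of configurations if any two configurations in the class that induce the same joint law of the observable pair $(X,Y)$ have the same value of that quantity. *)

theory Defs
  imports "HOL-Probability.Probability"
begin

definition cross_moment ::
    "'a measure \<Rightarrow> ('a \<Rightarrow> real^'m) \<Rightarrow> ('a \<Rightarrow> real^'n) \<Rightarrow> real^'n^'m" where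
  "cross_moment M U V = (\<chi> i j. LINT \<omega>|M. U \<omega> $ i * V \<omega> $ j)"

definition covariance :: "'a measure \<Rightarrow> ('a \<Rightarrow> real^'n) \<Rightarrow> real^'n^'n" where
  "covariance M U =
     cross_moment M (\<lambda>\<omega>. U \<omega> - (LINT \<omega>'|M. U \<omega>')) (\<lambda>\<omega>. U \<omega> - (LINT \<omega>'|M. U \<omega>'))"

definition mean_zero_L2 :: "'a measure \<Rightarrow> ('a \<Rightarrow> real^'n) \<Rightarrow> bool" where
  "mean_zero_L2 M U \<longleftrightarrow>
     U \<in> borel_measurable M \<and> integrable M (\<lambda>\<omega>. (norm (U \<omega>))\<^sup>2) \<and> (LINT \<omega>|M. U \<omega>) = 0"

text \<open>The library's \<open>indep_var\<close> requires both variables to have the same type; this is its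
  characterisation \<open>indep_var_eq\<close>, for variables of different types. The preimage families are
  already sigma-algebras.\<close>

definition indep_vectors ::
    "'a measure \<Rightarrow> ('a \<Rightarrow> 'b::topological_space) \<Rightarrow> ('a \<Rightarrow> 'c::topological_space) \<Rightarrow> bool" where
  "indep_vectors M U V \<longleftrightarrow>
     U \<in> borel_measurable M \<and> V \<in> borel_measurable M \<and>
     prob_space.indep_set M {U -` S \<inter> space M | S. S \<in> sets borel}
                            {V -` S \<inter> space M | S. S \<in> sets borel}"

definition positive_definite :: "real^'n^'n \<Rightarrow> bool" where
  "positive_definite S \<longleftrightarrow> transpose S = S \<and> (\<forall>v. v \<noteq> 0 \<longrightarrow> 0 < v \<bullet> (S *v v))"

definition diagonal_matrix :: "real^'n^'n \<Rightarrow> bool" where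
  "diagonal_matrix S \<longleftrightarrow> (\<forall>i j. i \<noteq> j \<longrightarrow> S $ i $ j = 0)"

text \<open>The dimensions \<open>p\<close>, \<open>K\<close>, \<open>m\<close> are the cardinalities of the index types \<open>'p\<close>, \<open>'k\<close>, \<open>'m\<close>;
  \<open>law\<close> is the joint law of \<open>(X, Z, E)\<close>. The hidden dimension \<open>K\<close> is thus part of the type of a
  configuration.\<close>

record ('p, 'k, 'm) configuration =
  Psi :: "real^'m^'p"
  B :: "real^'m^'k"
  law :: "((real^'p) \<times> (real^'k) \<times> (real^'m)) measure"

definition X :: "(real^'p) \<times> (real^'k) \<times> (real^'m) \<Rightarrow> real^'p" where
  "X \<omega> = fst \<omega>"

definition Z :: "(real^'p) \<times> (real^'k) \<times> (real^'m) \<Rightarrow> real^'k" where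
  "Z \<omega> = fst (snd \<omega>)"

definition E :: "(real^'p) \<times> (real^'k) \<times> (real^'m) \<Rightarrow> real^'m" where
  "E \<omega> = snd (snd \<omega>)"

definition is_configuration :: "('p::finite, 'k::finite, 'm::finite) configuration \<Rightarrow> bool" where
  "is_configuration C \<longleftrightarrow>
     CARD('k) < CARD('m) \<and>
     prob_space (law C) \<and> sets (law C) = sets borel \<and>
     rank (B C) = CARD('k) \<and>
     mean_zero_L2 (law C) X \<and> mean_zero_L2 (law C) Z \<and> mean_zero_L2 (law C) E \<and>
     indep_vectors (law C) E (\<lambda>\<omega>. (X \<omega>, Z \<omega>)) \<and>
     diagonal_matrix (covariance (law C) E) \<and>
     positive_definite (covariance (law C) X) \<and>
     positive_definite (covariance (law C) Z)"

definition Y :: "('p::finite, 'k::finite, 'm::finite) configuration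
    \<Rightarrow> (real^'p) \<times> (real^'k) \<times> (real^'m) \<Rightarrow> real^'m" where
  "Y C \<omega> = transpose (Psi C) *v X \<omega> + transpose (B C) *v Z \<omega> + E \<omega>"

definition observable_law ::
    "('p::finite, 'k::finite, 'm::finite) configuration \<Rightarrow> ((real^'p) \<times> (real^'m)) measure" where
  "observable_law C = distr (law C) borel (\<lambda>\<omega>. (X \<omega>, Y C \<omega>))"

definition A :: "('p::finite, 'k::finite, 'm::finite) configuration \<Rightarrow> real^'k^'p" where
  "A C = matrix_inv (cross_moment (law C) X X) ** cross_moment (law C) X Z"

definition W :: "('p::finite, 'k::finite, 'm::finite) configuration
    \<Rightarrow> (real^'p) \<times> (real^'k) \<times> (real^'m) \<Rightarrow> real^'k" where
  "W C \<omega> = Z \<omega> - transpose (A C) *v X \<omega>"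

lemma Y_eq:
  "Y C \<omega> = transpose (Psi C + A C ** B C) *v X \<omega> + transpose (B C) *v W C \<omega> + E \<omega>"
proof -
  have "transpose (Psi C + A C ** B C) = transpose (Psi C) + transpose (B C) ** transpose (A C)"
    unfolding matrix_transpose_mul[symmetric] by (simp add: transpose_def vec_eq_iff)
  then show ?thesis
    by (simp add: Y_def W_def matrix_vector_mult_add_rdistrib matrix_vector_mult_diff_distrib
        matrix_vector_mul_assoc del: transpose_matrix_vector)
qed

definition row_space_projection :: "real^'m^'k \<Rightarrow> real^'m^'m" where
  "row_space_projection b = transpose b ** matrix_inv (b ** transpose b) ** b"

definition Theta :: "('p::finite, 'k::finite, 'm::finite) configuration \<Rightarrow> real^'m^'p" where
  "Theta C = Psi C ** (mat 1 - row_space_projection (B C))"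

definition condition1 :: "('p::finite, 'k::finite, 'm::finite) configuration \<Rightarrow> bool" where
  "condition1 C \<longleftrightarrow> Psi C ** row_space_projection (B C) + A C ** B C = 0"

definition condition2 :: "('p::finite, 'k::finite, 'm::finite) configuration \<Rightarrow> bool" where
  "condition2 C \<longleftrightarrow>
     rank (covariance (law C) (W C)) = CARD('k) \<and>
     (\<exists>\<tau>::real. covariance (law C) E = \<tau>\<^sup>2 *\<^sub>R mat 1)"

end

theory Submission
  imports Defs
begin

text \<open>Since \<open>B\<^sup>* P\<^sup>\<bottom> = 0\<close>, \<open>\<Theta>\<^sup>* = F P\<^sup>\<bottom>\<close> for the coefficient matrix \<open>F = \<Psi>\<^sup>* + A\<^sup>* B\<^sup>*\<close> of the linear
  regression of \<open>Y\<close> on \<open>X\<close>, which the law of \<open>(X, Y)\<close> determines. Under the first condition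
  \<open>\<Theta>\<^sup>* = F\<close>. Under the second, the residual covariance \<open>S + \<tau>\<^sup>2 I\<close>, with \<open>S\<close> the positive
  semidefinite matrix \<open>(B\<^sup>*)\<^sup>T \<Sigma>\<^sub>W B\<^sup>*\<close>, is determined; \<open>S\<close> is singular because \<open>K < m\<close>, and evaluating
  two such decompositions on kernel vectors of their singular parts gives the same \<open>\<tau>\<^sup>2\<close>, hence
  the same \<open>S\<close>. Its kernel is that of \<open>B\<^sup>*\<close>, which determines the projection.\<close>

section \<open>Square-integrable centred random vectors\<close>

lemma integrable_mult_square:
  fixes f g :: "'a \<Rightarrow> real"
  assumes "f \<in> borel_measurable M" "g \<in> borel_measurable M"
    and "integrable M (\<lambda>\<omega>. (f \<omega>)\<^sup>2)" "integrable M (\<lambda>\<omega>. (g \<omega>)\<^sup>2)"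
  shows "integrable M (\<lambda>\<omega>. f \<omega> * g \<omega>)"
proof (rule Bochner_Integration.integrable_bound)
  show "integrable M (\<lambda>\<omega>. (f \<omega>)\<^sup>2 + (g \<omega>)\<^sup>2)"
    using assms by simp
  have "\<bar>a * b\<bar> \<le> a\<^sup>2 + b\<^sup>2" for a b :: real
  proof -
    have "2 * \<bar>a * b\<bar> \<le> a\<^sup>2 + b\<^sup>2"
      using sum_squares_bound[of "\<bar>a\<bar>" "\<bar>b\<bar>"] by (simp add: abs_mult)
    then show ?thesis
      by (smt (verit) abs_ge_zero)
  qed
  then show "AE \<omega> in M. norm (f \<omega> * g \<omega>) \<le> norm ((f \<omega>)\<^sup>2 + (g \<omega>)\<^sup>2)"
    by simp
qed (use assms in measurable)

lemma mean_zero_L2_measurable: "mean_zero_L2 M U \<Longrightarrow> U \<in> borel_measurable M"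
  by (simp add: mean_zero_L2_def)

lemma mean_zero_L2_component:
  fixes U :: "'a \<Rightarrow> real^'n"
  assumes "mean_zero_L2 M U"
  shows "(\<lambda>\<omega>. U \<omega> $ i) \<in> borel_measurable M" "integrable M (\<lambda>\<omega>. (U \<omega> $ i)\<^sup>2)"
proof -
  have U: "U \<in> borel_measurable M" "integrable M (\<lambda>\<omega>. (norm (U \<omega>))\<^sup>2)"
    using assms by (simp_all add: mean_zero_L2_def)
  show m: "(\<lambda>\<omega>. U \<omega> $ i) \<in> borel_measurable M"
    using borel_measurable_nth U(1) by (rule measurable_compose_rev)
  show "integrable M (\<lambda>\<omega>. (U \<omega> $ i)\<^sup>2)"
  proof (rule Bochner_Integration.integrable_bound[OF U(2)])
    show "AE \<omega> in M. norm ((U \<omega> $ i)\<^sup>2) \<le> norm ((norm (U \<omega>))\<^sup>2)"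
      using component_le_norm_cart by (intro AE_I2) (simp add: abs_le_square_iff[symmetric])
  qed (use m in measurable)
qed

lemma mean_zero_L2_integrable_mult:
  assumes "mean_zero_L2 M U" "mean_zero_L2 M V"
  shows "integrable M (\<lambda>\<omega>. U \<omega> $ i * V \<omega> $ j)"
  by (intro integrable_mult_square mean_zero_L2_component assms)

text \<open>Constants are integrable over a finite measure, so the bound
  \<open>a \<le> 1 + a\<^sup>2\<close> turns square integrability into integrability. This is what
  lets integrals be split and moved through linear maps below.\<close>

lemma (in finite_measure) mean_zero_L2_integrable:
  fixes U :: "'a \<Rightarrow> real^'n"
  assumes "mean_zero_L2 M U"
  shows "integrable M U"
proof (rule Bochner_Integration.integrable_bound)
  have U: "U \<in> borel_measurable M" "integrable M (\<lambda>\<omega>. (norm (U \<omega>))\<^sup>2)"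
    using assms by (simp_all add: mean_zero_L2_def)
  show "integrable M (\<lambda>\<omega>. 1 + (norm (U \<omega>))\<^sup>2)"
    using U by simp
  have "a \<le> 1 + a\<^sup>2" for a :: real
    using zero_le_power2[of "a - 1/2"] by (simp add: power2_eq_square algebra_simps)
  then show "AE \<omega> in M. norm (U \<omega>) \<le> norm (1 + (norm (U \<omega>))\<^sup>2)"
    by simp
  show "U \<in> borel_measurable M" by fact
qed

lemma (in finite_measure) mean_zero_L2_add:
  assumes "mean_zero_L2 M U" "mean_zero_L2 M V"
  shows "mean_zero_L2 M (\<lambda>\<omega>. U \<omega> + V \<omega>)"
  unfolding mean_zero_L2_def
proof (intro conjI)
  have UV: "U \<in> borel_measurable M" "integrable M (\<lambda>\<omega>. (norm (U \<omega>))\<^sup>2)"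
    "V \<in> borel_measurable M" "integrable M (\<lambda>\<omega>. (norm (V \<omega>))\<^sup>2)"
    "(LINT \<omega>|M. U \<omega>) = 0" "(LINT \<omega>|M. V \<omega>) = 0"
    using assms by (simp_all add: mean_zero_L2_def)
  show m: "(\<lambda>\<omega>. U \<omega> + V \<omega>) \<in> borel_measurable M"
    using UV by measurable
  show "(LINT \<omega>|M. U \<omega> + V \<omega>) = 0"
    using UV mean_zero_L2_integrable[OF assms(1)] mean_zero_L2_integrable[OF assms(2)] by simp
  show "integrable M (\<lambda>\<omega>. (norm (U \<omega> + V \<omega>))\<^sup>2)"
  proof (rule Bochner_Integration.integrable_bound)
    show "integrable M (\<lambda>\<omega>. 2 * (norm (U \<omega>))\<^sup>2 + 2 * (norm (V \<omega>))\<^sup>2)"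
      using UV by simp
    have "(norm (a + b))\<^sup>2 \<le> 2 * (norm a)\<^sup>2 + 2 * (norm b)\<^sup>2" for a b :: "real^'b"
    proof -
      have "(norm (a + b))\<^sup>2 \<le> (norm a + norm b)\<^sup>2"
        by (simp add: norm_triangle_ineq power_mono)
      also have "\<dots> \<le> 2 * (norm a)\<^sup>2 + 2 * (norm b)\<^sup>2"
        using sum_squares_bound[of "norm a" "norm b"] by (simp add: power2_sum)
      finally show ?thesis .
    qed
    then show "AE \<omega> in M. norm ((norm (U \<omega> + V \<omega>))\<^sup>2) \<le> norm (2 * (norm (U \<omega>))\<^sup>2 + 2 * (norm (V \<omega>))\<^sup>2)"
      by simp
  qed (use m in measurable)
qed

lemma (in finite_measure) mean_zero_L2_matrix:
  fixes G :: "real^'n^'l"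
  assumes "mean_zero_L2 M U"
  shows "mean_zero_L2 M (\<lambda>\<omega>. G *v U \<omega>)"
  unfolding mean_zero_L2_def
proof (intro conjI)
  have U: "U \<in> borel_measurable M" "integrable M (\<lambda>\<omega>. (norm (U \<omega>))\<^sup>2)" "(LINT \<omega>|M. U \<omega>) = 0"
    using assms by (simp_all add: mean_zero_L2_def)
  have bl: "bounded_linear ((*v) G)"
    by (rule matrix_vector_mul_bounded_linear)
  show m: "(\<lambda>\<omega>. G *v U \<omega>) \<in> borel_measurable M"
    using borel_measurable_continuous_onI[OF linear_continuous_on[OF bl]] U(1)
    by (rule measurable_compose_rev)
  show "(LINT \<omega>|M. G *v U \<omega>) = 0"
    using integral_bounded_linear[OF bl mean_zero_L2_integrable[OF assms]] U(3) by simp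
  show "integrable M (\<lambda>\<omega>. (norm (G *v U \<omega>))\<^sup>2)"
  proof (rule Bochner_Integration.integrable_bound)
    show "integrable M (\<lambda>\<omega>. (onorm ((*v) G))\<^sup>2 * (norm (U \<omega>))\<^sup>2)"
      using U by simp
    \<comment> \<open>The operator norm of \<open>G\<close> supplies the constant in the dominating
      function.\<close>
    show "AE \<omega> in M. norm ((norm (G *v U \<omega>))\<^sup>2) \<le> norm ((onorm ((*v) G))\<^sup>2 * (norm (U \<omega>))\<^sup>2)"
      using power_mono[OF onorm[OF bl] norm_ge_zero, of _ 2] by (simp add: power_mult_distrib)
  qed (use m in measurable)
qed

lemma borel_measurable_matrix_vector_mult:
  fixes G :: "real^'n^'l"
  shows "(*v) G \<in> borel_measurable borel"
  by (intro borel_measurable_continuous_onI linear_continuous_on matrix_vector_mul_bounded_linear)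

section \<open>Bilinearity and positivity of cross moments\<close>

lemma covariance_mean_zero_L2: "mean_zero_L2 M U \<Longrightarrow> covariance M U = cross_moment M U U"
  by (simp add: covariance_def mean_zero_L2_def)

lemma transpose_cross_moment: "transpose (cross_moment M U V) = cross_moment M V U"
  by (simp add: cross_moment_def transpose_def mult.commute)

lemma cross_moment_add_right:
  assumes "mean_zero_L2 M U" "mean_zero_L2 M V" "mean_zero_L2 M V'"
  shows "cross_moment M U (\<lambda>\<omega>. V \<omega> + V' \<omega>) = cross_moment M U V + cross_moment M U V'"
  by (simp add: cross_moment_def vec_eq_iff distrib_left mean_zero_L2_integrable_mult assms)

lemma cross_moment_matrix_right:
  assumes "mean_zero_L2 M U" "mean_zero_L2 M V"
  shows "cross_moment M U (\<lambda>\<omega>. G *v V \<omega>) = cross_moment M U V ** transpose G"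
proof -
  have "(LINT \<omega>|M. U \<omega> $ i * (\<Sum>k\<in>UNIV. G $ j $ k * V \<omega> $ k))
      = (\<Sum>k\<in>UNIV. (LINT \<omega>|M. U \<omega> $ i * V \<omega> $ k) * G $ j $ k)" for i j
  proof -
    have "(LINT \<omega>|M. U \<omega> $ i * (\<Sum>k\<in>UNIV. G $ j $ k * V \<omega> $ k))
      = (LINT \<omega>|M. (\<Sum>k\<in>UNIV. (U \<omega> $ i * V \<omega> $ k) * G $ j $ k))"
      by (simp add: sum_distrib_left mult_ac)
    also have "\<dots> = (\<Sum>k\<in>UNIV. (LINT \<omega>|M. U \<omega> $ i * V \<omega> $ k) * G $ j $ k)"
      by (subst Bochner_Integration.integral_sum)
        (simp_all add: mean_zero_L2_integrable_mult assms)
    finally show ?thesis .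
  qed
  then show ?thesis
    by (simp add: cross_moment_def vec_eq_iff matrix_matrix_mult_def matrix_vector_mult_def transpose_def)
qed

lemma cross_moment_add_left:
  assumes "mean_zero_L2 M U" "mean_zero_L2 M U'" "mean_zero_L2 M V"
  shows "cross_moment M (\<lambda>\<omega>. U \<omega> + U' \<omega>) V = cross_moment M U V + cross_moment M U' V"
  by (simp add: cross_moment_def vec_eq_iff distrib_right mean_zero_L2_integrable_mult assms)

lemma cross_moment_matrix_left:
  assumes "mean_zero_L2 M U" "mean_zero_L2 M V"
  shows "cross_moment M (\<lambda>\<omega>. G *v U \<omega>) V = G ** cross_moment M U V"
proof -
  \<comment> \<open>Transposition swaps the two arguments, which reduces the claim to the rule for
    the right argument.\<close>
  have "transpose (cross_moment M V (\<lambda>\<omega>. G *v U \<omega>)) = transpose (cross_moment M V U ** transpose G)"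
    by (simp add: cross_moment_matrix_right assms)
  then show ?thesis
    by (simp add: transpose_cross_moment matrix_transpose_mul)
qed

text \<open>Reading \<open>v\<close> as the matrix \<open>?G\<close> with a single row, the
  quadratic form is the only entry of the second moment of \<open>?G *v U \<omega>\<close>, that is,
  the integral of a square.\<close>

lemma (in finite_measure) cross_moment_quadratic_form_nonneg:
  assumes "mean_zero_L2 M U"
  shows "0 \<le> v \<bullet> (cross_moment M U U *v v)"
proof -
  let ?G = "(\<chi> i. v) :: real^'b^1"
  have "v \<bullet> (cross_moment M U U *v v) = (?G ** cross_moment M U U ** transpose ?G) $ 1 $ 1"
    by (simp add: matrix_matrix_mult_def matrix_vector_mult_def transpose_def inner_vec_def
        sum_distrib_left sum_distrib_right mult_ac) (subst sum.swap, intro sum.cong refl, simp add: mult_ac)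
  also have "?G ** cross_moment M U U ** transpose ?G
      = cross_moment M (\<lambda>\<omega>. ?G *v U \<omega>) (\<lambda>\<omega>. ?G *v U \<omega>)"
    by (simp add: cross_moment_matrix_left cross_moment_matrix_right mean_zero_L2_matrix assms
        matrix_mul_assoc)
  also have "\<dots> $ 1 $ 1 \<ge> 0"
    by (simp add: cross_moment_def)
  finally show ?thesis .
qed

section \<open>Independence and vanishing cross moments\<close>

lemma sigma_sets_preimages_comp_subset:
  fixes V :: "'a \<Rightarrow> 'b::topological_space" and g :: "'b \<Rightarrow> 'c::topological_space"
  assumes "g \<in> borel_measurable borel"
  shows "sigma_sets \<Omega> {(\<lambda>\<omega>. g (V \<omega>)) -` S \<inter> \<Omega> | S. S \<in> sets borel}
    \<subseteq> {V -` S \<inter> \<Omega> | S. S \<in> sets borel}"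
proof -
  \<comment> \<open>\<open>indep_var_eq\<close> speaks of generated sigma-algebras,
    \<open>indep_vectors\<close> of bare preimage families. Taking preimages commutes with
    generation, so the generated family is again one of preimages of Borel sets.\<close>
  have "{(\<lambda>\<omega>. g (V \<omega>)) -` S \<inter> \<Omega> | S. S \<in> sigma_sets UNIV (sets borel)}
      = sigma_sets \<Omega> {(\<lambda>\<omega>. g (V \<omega>)) -` S \<inter> \<Omega> | S. S \<in> sets borel}"
    by (rule sigma_sets_vimage_commute) simp
  moreover have "sigma_sets UNIV (sets (borel :: 'c measure)) = sets borel"
    using sets.sigma_sets_eq[of "borel :: 'c measure"] by simp
  moreover have "{(\<lambda>\<omega>. g (V \<omega>)) -` S \<inter> \<Omega> | S. S \<in> sets borel} \<subseteq> {V -` S \<inter> \<Omega> | S. S \<in> sets borel}"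
  proof safe
    fix S :: "'c set" assume "S \<in> sets borel"
    then have "g -` S \<in> sets borel"
      using measurable_sets[OF assms] by simp
    then show "\<exists>T. (\<lambda>\<omega>. g (V \<omega>)) -` S \<inter> \<Omega> = V -` T \<inter> \<Omega> \<and> T \<in> sets borel"
      by (intro exI[of _ "g -` S"]) auto
  qed
  ultimately show ?thesis by simp
qed

text \<open>Independence is inherited by smaller families of events, and every event of
  \<open>f (U \<omega>)\<close> or \<open>g (V \<omega>)\<close> is one of \<open>U\<close> or
  \<open>V\<close>. Both images are real, so the product rule for expectations under
  \<open>indep_var\<close> applies to them.\<close>

lemma (in prob_space) indep_vectors_comp:
  fixes f :: "'b::topological_space \<Rightarrow> real" and g :: "'c::topological_space \<Rightarrow> real"
  assumes ind: "indep_vectors M U V"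
    and f: "f \<in> borel_measurable borel" and g: "g \<in> borel_measurable borel"
  shows "indep_var borel (\<lambda>\<omega>. f (U \<omega>)) borel (\<lambda>\<omega>. g (V \<omega>))"
  unfolding indep_var_eq
proof (intro conjI)
  have UV: "U \<in> borel_measurable M" "V \<in> borel_measurable M"
    using ind by (simp_all add: indep_vectors_def)
  show "(\<lambda>\<omega>. f (U \<omega>)) \<in> borel_measurable M" "(\<lambda>\<omega>. g (V \<omega>)) \<in> borel_measurable M"
    using measurable_compose[OF UV(1) f] measurable_compose[OF UV(2) g] .
  have "indep_set {U -` S \<inter> space M | S. S \<in> sets borel} {V -` S \<inter> space M | S. S \<in> sets borel}"
    using ind by (simp add: indep_vectors_def)
  then show "indep_set (sigma_sets (space M) {(\<lambda>\<omega>. f (U \<omega>)) -` S \<inter> space M | S. S \<in> sets borel})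
      (sigma_sets (space M) {(\<lambda>\<omega>. g (V \<omega>)) -` S \<inter> space M | S. S \<in> sets borel})"
    unfolding indep_set_def
    by (rule indep_sets_mono_sets)
      (auto split: bool.split simp del: mem_Collect_eq
        dest: subsetD[OF sigma_sets_preimages_comp_subset[OF f]]
          subsetD[OF sigma_sets_preimages_comp_subset[OF g]])
qed

text \<open>Each entry factors into a product of two expectations, the first of which is zero. The
  map \<open>g\<close> allows \<open>V\<close> to be the pair \<open>(X, Z)\<close> while the cross
  moment is taken with \<open>X\<close> or \<open>W\<close>.\<close>

lemma (in prob_space) cross_moment_indep_vectors:
  fixes U :: "'a \<Rightarrow> real^'n" and V :: "'a \<Rightarrow> 'c::topological_space" and g :: "'c \<Rightarrow> real^'l"
  assumes ind: "indep_vectors M U V" and g: "g \<in> borel_measurable borel"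
    and U: "mean_zero_L2 M U" and gV: "mean_zero_L2 M (\<lambda>\<omega>. g (V \<omega>))"
  shows "cross_moment M U (\<lambda>\<omega>. g (V \<omega>)) = 0"
proof -
  have "(LINT \<omega>|M. U \<omega> $ i * g (V \<omega>) $ j) = 0" for i j
  proof -
    have iU: "integrable M (\<lambda>\<omega>. U \<omega> $ i)"
      using integrable_bounded_linear[OF bounded_linear_vec_nth mean_zero_L2_integrable[OF U]] .
    have iV: "integrable M (\<lambda>\<omega>. g (V \<omega>) $ j)"
      using integrable_bounded_linear[OF bounded_linear_vec_nth mean_zero_L2_integrable[OF gV]] .
    have "indep_var borel (\<lambda>\<omega>. U \<omega> $ i) borel (\<lambda>\<omega>. g (V \<omega>) $ j)"
      by (rule indep_vectors_comp[OF ind, where f = "\<lambda>x. x $ i" and g = "\<lambda>x. g x $ j"])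
        (use g borel_measurable_nth in \<open>auto intro: measurable_compose\<close>)
    then have "(LINT \<omega>|M. U \<omega> $ i * g (V \<omega>) $ j) = (LINT \<omega>|M. U \<omega> $ i) * (LINT \<omega>|M. g (V \<omega>) $ j)"
      using iU iV by (rule indep_var_lebesgue_integral)
    also have "(LINT \<omega>|M. U \<omega> $ i) = (LINT \<omega>|M. U \<omega>) $ i"
      by (rule integral_bounded_linear[OF bounded_linear_vec_nth mean_zero_L2_integrable[OF U]])
    finally show ?thesis
      using U by (simp add: mean_zero_L2_def)
  qed
  then show ?thesis
    by (simp add: cross_moment_def vec_eq_iff)
qed

section \<open>Matrix arithmetic, inverses and full row rank\<close>

lemma matrix_mult_diff_right:
  fixes G :: "real^'n^'l"
  shows "G ** (H - H') = G ** H - G ** H'"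
  by (simp add: matrix_matrix_mult_def vec_eq_iff right_diff_distrib sum_subtractf)

lemma matrix_mult_add_left:
  fixes G :: "real^'n^'l"
  shows "(G + G') ** H = G ** H + G' ** H"
  by (simp add: matrix_matrix_mult_def vec_eq_iff distrib_right sum.distrib)

lemma matrix_mult_minus_right:
  fixes G :: "real^'n^'l"
  shows "G ** (- H) = - (G ** H)"
  by (simp add: matrix_matrix_mult_def vec_eq_iff sum_negf)

lemma matrix_vector_mult_minus_left:
  fixes G :: "real^'n^'l"
  shows "(- G) *v x = - (G *v x)"
  by (simp add: matrix_vector_mult_def vec_eq_iff sum_negf)

lemma invertible_iff_kernel:
  fixes S :: "real^'n^'n"
  shows "invertible S \<longleftrightarrow> (\<forall>v. S *v v = 0 \<longrightarrow> v = 0)"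
  by (simp add: invertible_left_inverse matrix_left_invertible_ker)

lemma matrix_inv_mult:
  assumes "invertible S"
  shows "S ** matrix_inv S = mat 1" "matrix_inv S ** S = mat 1"
  using someI_ex[OF assms[unfolded invertible_def]] by (simp_all add: matrix_inv_def)

lemma transpose_matrix_inv:
  fixes S :: "real^'n^'n"
  assumes "invertible S" "transpose S = S"
  shows "transpose (matrix_inv S) = matrix_inv S"
proof -
  have "transpose (matrix_inv S) ** S = mat 1"
    using arg_cong[OF matrix_inv_mult(1)[OF assms(1)], of transpose] assms(2)
    by (simp add: matrix_transpose_mul transpose_mat)
  then have "transpose (matrix_inv S) ** S ** matrix_inv S = matrix_inv S"
    by simp
  then show ?thesis
    by (simp add: matrix_mul_assoc[symmetric] matrix_inv_mult[OF assms(1)])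
qed

lemma positive_definite_invertible: "positive_definite S \<Longrightarrow> invertible S"
  by (force simp: positive_definite_def invertible_iff_kernel)

lemma transpose_injective:
  fixes b :: "real^'m^'k"
  assumes "rank b = CARD('k)" "transpose b *v v = 0"
  shows "v = 0"
  using assms matrix_nonfull_linear_equations_eq[of "transpose b"] rank_transpose[of b] by auto

lemma invertible_gram:
  fixes b :: "real^'m^'k"
  assumes "rank b = CARD('k)"
  shows "invertible (b ** transpose b)"
  unfolding invertible_iff_kernel
proof safe
  fix v assume v: "(b ** transpose b) *v v = 0"
  \<comment> \<open>The quadratic form of the Gram matrix at \<open>v\<close> is the squared norm of
    \<open>transpose b *v v\<close>, and full row rank makes \<open>transpose b\<close>
    injective.\<close>
  have "(transpose b *v v) \<bullet> (transpose b *v v) = v \<bullet> ((b ** transpose b) *v v)"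
    by (simp add: dot_lmul_matrix flip: matrix_vector_mul_assoc)
  with v have "transpose b *v v = 0"
    by (simp del: transpose_matrix_vector)
  then show "v = 0"
    by (rule transpose_injective[OF assms])
qed

section \<open>Projections onto row spaces\<close>

lemma row_space_projection_left:
  fixes b :: "real^'m^'k"
  assumes "rank b = CARD('k)"
  shows "b ** row_space_projection b = b"
proof -
  have "b ** row_space_projection b = (b ** transpose b) ** matrix_inv (b ** transpose b) ** b"
    by (simp add: row_space_projection_def matrix_mul_assoc)
  then show ?thesis
    by (simp add: matrix_inv_mult invertible_gram assms)
qed

lemma transpose_row_space_projection:
  fixes b :: "real^'m^'k"
  assumes "rank b = CARD('k)"
  shows "transpose (row_space_projection b) = row_space_projection b"
proof -
  have "transpose (matrix_inv (b ** transpose b)) = matrix_inv (b ** transpose b)"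
    by (rule transpose_matrix_inv[OF invertible_gram[OF assms]]) (simp add: matrix_transpose_mul)
  then show ?thesis
    by (simp add: row_space_projection_def matrix_transpose_mul matrix_mul_assoc)
qed

text \<open>The vector \<open>x - row_space_projection b *v x\<close> lies in the kernel of
  \<open>b\<close>, hence in that of \<open>c\<close>. So \<open>c\<close> does not see the
  difference between \<open>x\<close> and its projection, and the last factor of
  \<open>row_space_projection c\<close> absorbs \<open>row_space_projection b\<close>.\<close>

lemma row_space_projection_absorb:
  fixes b :: "real^'m^'k" and c :: "real^'m^'l"
  assumes b: "rank b = CARD('k)" and ker: "\<And>v. b *v v = 0 \<Longrightarrow> c *v v = 0"
  shows "row_space_projection c ** row_space_projection b = row_space_projection c"
proof -
  have "c *v x = c *v (row_space_projection b *v x)" for x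
  proof -
    have "b *v (x - row_space_projection b *v x) = 0"
      by (simp add: matrix_vector_mult_diff_distrib matrix_vector_mul_assoc row_space_projection_left b)
    from ker[OF this] show ?thesis
      by (simp add: matrix_vector_mult_diff_distrib)
  qed
  then have "c ** row_space_projection b = c"
    by (simp add: matrix_eq matrix_vector_mul_assoc)
  then show ?thesis
    by (simp add: row_space_projection_def[of c] flip: matrix_mul_assoc)
qed

text \<open>With equal kernels the two projections absorb each other; since both are symmetric,
  transposing one absorption identity and comparing it with the other gives equality. The row index
  types may differ, as the hidden dimensions of two configurations may.\<close>

lemma row_space_projection_cong:
  fixes b :: "real^'m^'k" and c :: "real^'m^'l"
  assumes b: "rank b = CARD('k)" and c: "rank c = CARD('l)"
    and ker: "\<And>v. b *v v = 0 \<longleftrightarrow> c *v v = 0"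
  shows "row_space_projection b = row_space_projection c"
proof -
  have "row_space_projection b = transpose (row_space_projection b ** row_space_projection c)"
    by (simp add: row_space_projection_absorb c ker transpose_row_space_projection b)
  also have "\<dots> = row_space_projection c ** row_space_projection b"
    by (simp add: matrix_transpose_mul transpose_row_space_projection b c)
  also have "\<dots> = row_space_projection c"
    by (rule row_space_projection_absorb[OF b]) (simp add: ker)
  finally show ?thesis .
qed

section \<open>Low-rank matrices plus a multiple of the identity\<close>

lemma singular_part_shift_le:
  fixes S S' :: "real^'n^'n"
  assumes eq: "S + t *\<^sub>R mat 1 = S' + t' *\<^sub>R mat 1"
    and v: "v \<noteq> 0" "S *v v = 0" and psd: "0 \<le> v \<bullet> (S' *v v)"
  shows "t' \<le> t"
proof -
  \<comment> \<open>Both sides of \<open>eq\<close> are tested on the kernel vector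
    \<open>v\<close>: the left gives \<open>t\<close> times its squared length, the right at least
    \<open>t'\<close> times it.\<close>
  have "v \<bullet> ((S + t *\<^sub>R mat 1) *v v) = t * (v \<bullet> v)"
    using v by (simp add: matrix_vector_mult_add_rdistrib flip: scaleR_matrix_vector_assoc)
  moreover have "v \<bullet> ((S' + t' *\<^sub>R mat 1) *v v) = v \<bullet> (S' *v v) + t' * (v \<bullet> v)"
    by (simp add: matrix_vector_mult_add_rdistrib inner_add_right flip: scaleR_matrix_vector_assoc)
  ultimately have "t' * (v \<bullet> v) \<le> t * (v \<bullet> v)"
    using psd eq by simp
  then show ?thesis
    using v by simp
qed

text \<open>The factors \<open>transpose b\<close> and \<open>S\<close> are both injective by their
  ranks, so only \<open>b\<close> can annihilate a vector.\<close>

lemma congruence_kernel: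
  fixes b :: "real^'m^'k"
  assumes "rank b = CARD('k)" "rank S = CARD('k)"
  shows "(transpose b ** S ** b) *v v = 0 \<longleftrightarrow> b *v v = 0"
proof
  assume "(transpose b ** S ** b) *v v = 0"
  then have "transpose b *v (S *v (b *v v)) = 0"
    by (simp add: matrix_vector_mul_assoc matrix_mul_assoc del: transpose_matrix_vector)
  then have "S *v (b *v v) = 0"
    by (rule transpose_injective[OF assms(1)])
  then show "b *v v = 0"
    using assms(2) matrix_nonfull_linear_equations_eq[of S] by auto
next
  assume "b *v v = 0"
  then show "(transpose b ** S ** b) *v v = 0"
    by (simp flip: matrix_vector_mul_assoc)
qed

lemma congruence_quadratic_form:
  fixes b :: "real^'m^'k"
  shows "v \<bullet> ((transpose b ** S ** b) *v v) = (b *v v) \<bullet> (S *v (b *v v))"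
  using dot_lmul_matrix[of "S *v (b *v v)" b v]
  by (simp add: inner_commute flip: matrix_vector_mul_assoc)

lemma low_rank_plus_scalar_kernel:
  fixes b :: "real^'m^'k" and c :: "real^'m^'l"
  assumes b: "CARD('k) < CARD('m)" "rank b = CARD('k)" "rank S = CARD('k)"
    and c: "CARD('l) < CARD('m)" "rank c = CARD('l)" "rank T = CARD('l)"
    and psd: "\<And>v. 0 \<le> v \<bullet> (S *v v)" "\<And>v. 0 \<le> v \<bullet> (T *v v)"
    and eq: "transpose b ** S ** b + s *\<^sub>R mat 1 = transpose c ** T ** c + t *\<^sub>R mat 1"
  shows "b *v v = 0 \<longleftrightarrow> c *v v = 0"
proof -
  have psd': "0 \<le> u \<bullet> ((transpose b ** S ** b) *v u)" "0 \<le> u \<bullet> ((transpose c ** T ** c) *v u)" for u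
    using psd(1)[of "b *v u"] psd(2)[of "c *v u"] by (simp_all add: congruence_quadratic_form)
  \<comment> \<open>The rank of \<open>b\<close> is below its number of columns, so a nonzero kernel
    vector exists; it also lies in the kernel of \<open>transpose b ** S ** b\<close>.\<close>
  obtain u where u: "u \<noteq> 0" "b *v u = 0"
    using b matrix_nonfull_linear_equations_eq[of b] by auto
  obtain w where w: "w \<noteq> 0" "c *v w = 0"
    using c matrix_nonfull_linear_equations_eq[of c] by auto
  have "t \<le> s"
    using singular_part_shift_le[OF eq u(1) _ psd'(2)] u b by (simp add: congruence_kernel)
  moreover have "s \<le> t"
    using singular_part_shift_le[OF eq[symmetric] w(1) _ psd'(1)] w c by (simp add: congruence_kernel)
  ultimately have "transpose b ** S ** b = transpose c ** T ** c"
    using eq by simp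
  then show ?thesis
    using congruence_kernel[OF b(2,3)] congruence_kernel[OF c(2,3)] by metis
qed

section \<open>Regression of the response on the observed covariates\<close>

definition regression_coefficients ::
    "('p::finite, 'k::finite, 'm::finite) configuration \<Rightarrow> real^'m^'p" where
  "regression_coefficients C = Psi C + A C ** B C"

lemma is_configurationD:
  fixes C :: "('p::finite, 'k::finite, 'm::finite) configuration"
  assumes "is_configuration C"
  shows "CARD('k) < CARD('m)" "prob_space (law C)" "sets (law C) = sets borel"
    "rank (B C) = CARD('k)"
    "mean_zero_L2 (law C) X" "mean_zero_L2 (law C) Z" "mean_zero_L2 (law C) E"
    "indep_vectors (law C) E (\<lambda>\<omega>. (X \<omega>, Z \<omega>))"
    "positive_definite (covariance (law C) X)"
  using assms by (simp_all add: is_configuration_def)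

lemma Theta_eq_regression_coefficients:
  assumes "is_configuration C"
  shows "Theta C = regression_coefficients C ** (mat 1 - row_space_projection (B C))"
proof -
  have "A C ** B C ** (mat 1 - row_space_projection (B C)) = 0"
    by (simp add: matrix_mult_diff_right row_space_projection_left is_configurationD[OF assms]
        flip: matrix_mul_assoc)
  then show ?thesis
    by (simp add: Theta_def regression_coefficients_def matrix_mult_add_left)
qed

lemma Theta_eq_regression_coefficients_condition1:
  assumes "condition1 C"
  shows "Theta C = regression_coefficients C"
proof -
  \<comment> \<open>The projected part of \<open>Psi C\<close> is subtracted and added back, so that
    the bracket is exactly the quantity that \<open>condition1\<close> makes zero.\<close>
  have "regression_coefficients C
      = Psi C - Psi C ** row_space_projection (B C) + (Psi C ** row_space_projection (B C) + A C ** B C)"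
    by (simp add: regression_coefficients_def)
  also have "\<dots> = Theta C"
    using assms by (simp add: condition1_def Theta_def matrix_mult_diff_right)
  finally show ?thesis ..
qed

lemma mean_zero_L2_W:
  assumes "is_configuration C"
  shows "mean_zero_L2 (law C) (W C)"
proof -
  interpret prob_space "law C"
    by (rule is_configurationD[OF assms])
  have "mean_zero_L2 (law C) (\<lambda>\<omega>. Z \<omega> + (- transpose (A C)) *v X \<omega>)"
    by (intro mean_zero_L2_add mean_zero_L2_matrix is_configurationD[OF assms])
  then show ?thesis
    by (simp add: W_def[abs_def] matrix_vector_mult_minus_left)
qed

text \<open>\<open>A C\<close> solves the normal equations for regressing \<open>Z\<close> on
  \<open>X\<close>. As \<open>X\<close> is centred, its second moment is its positive definite
  covariance, so the \<open>matrix_inv\<close> in \<open>A\<close> is a genuine inverse.\<close>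

lemma cross_moment_X_W:
  assumes "is_configuration C"
  shows "cross_moment (law C) X (W C) = 0"
proof -
  interpret prob_space "law C"
    by (rule is_configurationD[OF assms])
  note L2 = is_configurationD(5-7)[OF assms]
  have inv: "invertible (cross_moment (law C) X X)"
    using positive_definite_invertible[OF is_configurationD(9)[OF assms]] covariance_mean_zero_L2[OF L2(1)]
    by simp
  have "cross_moment (law C) X (W C)
      = cross_moment (law C) X (\<lambda>\<omega>. Z \<omega> + (- transpose (A C)) *v X \<omega>)"
    by (simp add: W_def[abs_def] matrix_vector_mult_minus_left)
  also have "\<dots> = cross_moment (law C) X Z + cross_moment (law C) X X ** transpose (- transpose (A C))"
    by (simp only: cross_moment_add_right cross_moment_matrix_right mean_zero_L2_matrix L2)
  also have "transpose (- transpose (A C)) = - A C"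
    by (simp add: transpose_def vec_eq_iff)
  also have "cross_moment (law C) X X ** (- A C) = - cross_moment (law C) X Z"
    by (simp add: A_def matrix_mul_assoc matrix_inv_mult[OF inv] matrix_mult_minus_right)
  finally show ?thesis
    by simp
qed

lemma cross_moment_E:
  assumes "is_configuration C"
  shows "cross_moment (law C) E X = 0" "cross_moment (law C) E (W C) = 0"
proof -
  interpret prob_space "law C"
    by (rule is_configurationD[OF assms])
  note ind = cross_moment_indep_vectors[OF is_configurationD(8)[OF assms] _ is_configurationD(7)[OF assms]]
  show "cross_moment (law C) E X = 0"
    using ind[of fst] is_configurationD(5)[OF assms]
    by (simp add: borel_measurable_continuous_onI continuous_on_fst)
  \<comment> \<open>\<open>W\<close> is a Borel function of the pair \<open>(X, Z)\<close>, of which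
    \<open>E\<close> is independent.\<close>
  have W: "W C = (\<lambda>\<omega>. (\<lambda>(x, z). z - transpose (A C) *v x) (X \<omega>, Z \<omega>))"
    by (simp add: W_def[abs_def])
  have "(\<lambda>(x, z). z - transpose (A C) *v x) \<in> borel_measurable borel"
    unfolding case_prod_unfold
    by (intro borel_measurable_diff measurable_compose[OF _ borel_measurable_matrix_vector_mult]
        borel_measurable_continuous_onI continuous_intros)
  from ind[OF this] mean_zero_L2_W[OF assms]
  show "cross_moment (law C) E (W C) = 0"
    by (simp only: W[symmetric])
qed

lemma mean_zero_L2_residual:
  assumes "is_configuration C"
  shows "mean_zero_L2 (law C) (\<lambda>\<omega>. transpose (B C) *v W C \<omega> + E \<omega>)"
proof -
  interpret prob_space "law C"
    by (rule is_configurationD[OF assms])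
  show ?thesis
    by (intro mean_zero_L2_add mean_zero_L2_matrix mean_zero_L2_W is_configurationD[OF assms] assms)
qed

lemma Y_eq_regression:
  "Y C = (\<lambda>\<omega>. transpose (regression_coefficients C) *v X \<omega> + (transpose (B C) *v W C \<omega> + E \<omega>))"
  by (simp add: fun_eq_iff Y_eq regression_coefficients_def add.assoc del: transpose_matrix_vector)

text \<open>These are the normal equations: \<open>W\<close> and \<open>E\<close> are both
  uncorrelated with \<open>X\<close>, so only the linear term in \<open>X\<close>
  contributes.\<close>

lemma cross_moment_X_Y:
  assumes "is_configuration C"
  shows "cross_moment (law C) X (Y C) = cross_moment (law C) X X ** regression_coefficients C"
proof -
  interpret prob_space "law C"
    by (rule is_configurationD[OF assms])
  note L2 = is_configurationD(5-7)[OF assms] mean_zero_L2_W[OF assms]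
  have "cross_moment (law C) X E = 0"
    using transpose_cross_moment[of "law C" E X] cross_moment_E(1)[OF assms]
    by (simp add: transpose_def vec_eq_iff)
  then show ?thesis
    unfolding Y_eq_regression
    by (simp add: cross_moment_add_right cross_moment_matrix_right mean_zero_L2_add mean_zero_L2_matrix
        L2 cross_moment_X_W[OF assms] del: transpose_matrix_vector)
qed

text \<open>The mixed terms vanish because \<open>E\<close> and \<open>W\<close> are uncorrelated.
  Writing \<open>R\<close> through \<open>Y\<close> and \<open>X\<close> shows it as a function of
  the observable pair once the coefficients are known.\<close>

lemma residual_second_moment:
  assumes "is_configuration C"
  defines "R \<equiv> \<lambda>\<omega>. Y C \<omega> - transpose (regression_coefficients C) *v X \<omega>"
  shows "cross_moment (law C) R R
    = transpose (B C) ** covariance (law C) (W C) ** B C + covariance (law C) E"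
proof -
  interpret prob_space "law C"
    by (rule is_configurationD[OF assms(1)])
  note L2 = is_configurationD(5-7)[OF assms(1)] mean_zero_L2_W[OF assms(1)]
  have "cross_moment (law C) (W C) E = 0"
    using transpose_cross_moment[of "law C" E "W C"] cross_moment_E(2)[OF assms(1)]
    by (simp add: transpose_def vec_eq_iff)
  moreover have "R = (\<lambda>\<omega>. transpose (B C) *v W C \<omega> + E \<omega>)"
    by (simp add: R_def Y_eq_regression del: transpose_matrix_vector)
  ultimately show ?thesis
    by (simp add: cross_moment_add_right cross_moment_add_left cross_moment_matrix_right
        cross_moment_matrix_left mean_zero_L2_add mean_zero_L2_matrix L2 covariance_mean_zero_L2
        cross_moment_E[OF assms(1)] matrix_mul_assoc del: transpose_matrix_vector)
qed

section \<open>Quantities determined by the observable law\<close>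

lemma cross_moment_observable_law:
  fixes C :: "('p::finite, 'k::finite, 'm::finite) configuration"
  assumes "is_configuration C" "U \<in> borel_measurable borel" "V \<in> borel_measurable borel"
  shows "cross_moment (observable_law C) U V
    = cross_moment (law C) (\<lambda>\<omega>. U (X \<omega>, Y C \<omega>)) (\<lambda>\<omega>. V (X \<omega>, Y C \<omega>))"
proof -
  interpret prob_space "law C"
    by (rule is_configurationD[OF assms(1)])
  have "X \<in> borel_measurable (law C)"
    by (rule mean_zero_L2_measurable is_configurationD assms)+
  moreover have "Y C \<in> borel_measurable (law C)"
    unfolding Y_eq_regression
    by (intro borel_measurable_add mean_zero_L2_measurable[OF mean_zero_L2_residual[OF assms(1)]]
        mean_zero_L2_measurable[OF mean_zero_L2_matrix] is_configurationD[OF assms(1)])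
  ultimately have XY: "(\<lambda>\<omega>. (X \<omega>, Y C \<omega>)) \<in> borel_measurable (law C)"
    by (rule borel_measurable_Pair)
  have "(\<lambda>\<omega>. U \<omega> $ i * V \<omega> $ j) \<in> borel_measurable borel" for i j
    using measurable_compose[OF assms(2) borel_measurable_nth] measurable_compose[OF assms(3) borel_measurable_nth]
    by (rule borel_measurable_times)
  then show ?thesis
    by (simp add: cross_moment_def observable_law_def integral_distr[OF XY])
qed

text \<open>Both coefficient matrices solve normal equations with the same invertible second moment
  of \<open>X\<close> and the same cross moment of \<open>X\<close> and \<open>Y\<close>.\<close>

lemma regression_coefficients_eqI:
  fixes C :: "('p::finite, 'k::finite, 'm::finite) configuration"
    and C' :: "('p, 'l::finite, 'm) configuration"
  assumes C: "is_configuration C" and C': "is_configuration C'"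
    and eq: "observable_law C = observable_law C'"
  shows "regression_coefficients C = regression_coefficients C'"
proof -
  have m: "fst \<in> borel_measurable borel" "snd \<in> borel_measurable borel"
    by (intro borel_measurable_continuous_onI continuous_intros)+
  have XX: "cross_moment (law C) X X = cross_moment (law C') X X"
    using cross_moment_observable_law[OF C m(1) m(1)] cross_moment_observable_law[OF C' m(1) m(1)] eq
    by simp
  have XY: "cross_moment (law C) X (Y C) = cross_moment (law C') X (Y C')"
    using cross_moment_observable_law[OF C m] cross_moment_observable_law[OF C' m] eq
    by simp
  have inv: "invertible (cross_moment (law C) X X)"
    using positive_definite_invertible[OF is_configurationD(9)[OF C]]
      covariance_mean_zero_L2[OF is_configurationD(5)[OF C]] by simp
  have "matrix_inv (cross_moment (law C) X X) ** (cross_moment (law C) X X ** regression_coefficients C)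
      = matrix_inv (cross_moment (law C) X X) ** (cross_moment (law C) X X ** regression_coefficients C')"
    using XX XY by (simp add: cross_moment_X_Y C C')
  then show ?thesis
    by (simp add: matrix_mul_assoc matrix_inv_mult[OF inv])
qed

text \<open>The coefficients agree, so the single function \<open>?R\<close> of the observable pair
  yields the residual of either configuration; its second moment under the common law is computed in
  both ways.\<close>

lemma residual_covariance_eqI:
  fixes C :: "('p::finite, 'k::finite, 'm::finite) configuration"
    and C' :: "('p, 'l::finite, 'm) configuration"
  assumes C: "is_configuration C" and C': "is_configuration C'"
    and eq: "observable_law C = observable_law C'"
  shows "transpose (B C) ** covariance (law C) (W C) ** B C + covariance (law C) E
    = transpose (B C') ** covariance (law C') (W C') ** B C' + covariance (law C') E"
proof -
  let ?R = "\<lambda>xy. snd xy - transpose (regression_coefficients C) *v fst xy"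
  note coeff = regression_coefficients_eqI[OF assms]
  have m: "?R \<in> borel_measurable borel"
    by (intro borel_measurable_diff measurable_compose[OF _ borel_measurable_matrix_vector_mult]
        borel_measurable_continuous_onI continuous_intros)
  have "cross_moment (observable_law C) ?R ?R
      = transpose (B C) ** covariance (law C) (W C) ** B C + covariance (law C) E"
    unfolding cross_moment_observable_law[OF C m m] fst_conv snd_conv
    by (rule residual_second_moment[OF C])
  moreover have "cross_moment (observable_law C') ?R ?R
      = transpose (B C') ** covariance (law C') (W C') ** B C' + covariance (law C') E"
    unfolding coeff cross_moment_observable_law[OF C' m[unfolded coeff] m[unfolded coeff]] fst_conv snd_conv
    by (rule residual_second_moment[OF C'])
  ultimately show ?thesis
    using eq by simp
qed

text \<open>The noise levels \<open>t\<close> and \<open>t'\<close> are not assumed equal; the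
  comparison of kernels copes with two different scalar shifts. Positivity of the low-rank parts
  comes from \<open>covariance (law C) (W C)\<close> being a second moment.\<close>

lemma condition2_row_space_projection_eqI:
  fixes C :: "('p::finite, 'k::finite, 'm::finite) configuration"
    and C' :: "('p, 'l::finite, 'm) configuration"
  assumes C: "is_configuration C" and C': "is_configuration C'"
    and eq: "observable_law C = observable_law C'"
    and cond: "condition2 C" "condition2 C'"
  shows "row_space_projection (B C) = row_space_projection (B C')"
proof (rule row_space_projection_cong)
  interpret C: prob_space "law C"
    by (rule is_configurationD[OF C])
  interpret C': prob_space "law C'"
    by (rule is_configurationD[OF C'])
  obtain t where t: "covariance (law C) E = t\<^sup>2 *\<^sub>R mat 1"
    using cond(1) by (auto simp: condition2_def)
  obtain t' where t': "covariance (law C') E = t'\<^sup>2 *\<^sub>R mat 1"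
    using cond(2) by (auto simp: condition2_def)
  show "B C *v v = 0 \<longleftrightarrow> B C' *v v = 0" for v
  proof (rule low_rank_plus_scalar_kernel)
    show "transpose (B C) ** covariance (law C) (W C) ** B C + t\<^sup>2 *\<^sub>R mat 1
        = transpose (B C') ** covariance (law C') (W C') ** B C' + t'\<^sup>2 *\<^sub>R mat 1"
      using residual_covariance_eqI[OF C C' eq] t t' by simp
    show "rank (covariance (law C) (W C)) = CARD('k)" "rank (covariance (law C') (W C')) = CARD('l)"
      using cond by (simp_all add: condition2_def)
    show "0 \<le> u \<bullet> (covariance (law C) (W C) *v u)" for u
      using C.cross_moment_quadratic_form_nonneg[OF mean_zero_L2_W[OF C]]
      by (simp add: covariance_mean_zero_L2[OF mean_zero_L2_W[OF C]])
    show "0 \<le> u \<bullet> (covariance (law C') (W C') *v u)" for u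
      using C'.cross_moment_quadratic_form_nonneg[OF mean_zero_L2_W[OF C']]
      by (simp add: covariance_mean_zero_L2[OF mean_zero_L2_W[OF C']])
  qed (fact is_configurationD[OF C] is_configurationD[OF C'])+
qed (fact is_configurationD[OF C] is_configurationD[OF C'])+

text \<open>The hidden index types \<open>'k\<close> and \<open>'l\<close> are independent of each
  other, so the hidden dimension is not fixed in advance.\<close>

theorem proposition2:
  fixes C :: "('p::finite, 'k::finite, 'm::finite) configuration"
    and C' :: "('p, 'l::finite, 'm) configuration"
  assumes "is_configuration C" and "is_configuration C'"
    and "observable_law C = observable_law C'"
  shows "(condition1 C \<and> condition1 C' \<longrightarrow> Theta C = Theta C') \<and>
         (condition2 C \<and> condition2 C' \<longrightarrow> Theta C = Theta C')"
proof (intro conjI impI; elim conjE)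
  note coeff = regression_coefficients_eqI[OF assms]
  show "Theta C = Theta C'" if "condition1 C" "condition1 C'"
    using that coeff by (simp add: Theta_eq_regression_coefficients_condition1)
  show "Theta C = Theta C'" if "condition2 C" "condition2 C'"
    using coeff condition2_row_space_projection_eqI[OF assms that]
    by (simp add: Theta_eq_regression_coefficients assms)
qed

end
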